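(* Let $p$ be an essentially bounded exponent function on $\mathbb{R}^n$ with essential upper bound $p^+$. There exists a constant $C(n,p^+)>0$, depending only on $n$ and $p^+$, such that \[ \left\|\chi_{\{x\in Q:\,|f(x)-f_Q|\ge t\}}\right\|_{L^{p(\cdot)}\left(Q,\frac{dx}{|Q|}\right)}\le 2\,e^{-C(n,p^+)\,t/\|f\|_{\mathrm{BMO}}} \] for every $t>0$, every cube $Q$ in $\mathbb{R}^n$ and every $f\in\mathrm{BMO}$.
   Context: An exponent function is a Lebesgue measurable function $p:\mathbb{R}^n\to[1,\infty]$; $p^+=\operatorname{ess\,sup}_{x\in\mathbb{R}^n}p(x)$, and essentially bounded means $p^+<\infty$. The local average is \[ \|f\|_{L^{p(\cdot)}\left(Q,\frac{dx}{|Q|}\right)}=\inf\left\{\lambda>0:\frac1{|Q|}\int_Q\left(\frac{|f(x)|}{\lambda}\right)^{p(x)}dx\le1\right\}. \] $f_Q=\frac1{|Q|}\int_Qf\,dx$, $\|f\|_{\mathrm{BMO}}=\sup_Q\frac1{|Q|}\int_Q|f-f_Q|\,dx$ over all cubes $Q\subset\mathbb{R}^n$, and $\mathrm{BMO}$ is the set of $f\in L^1_{\mathrm{loc}}(\mathbb{R}^n)$ with $\|f\|_{\mathrm{BMO}}<\infty$ (Lebesgue measure throughout). If $\|f\|_{\mathrm{BMO}}=0$ the right-hand side is read as $0$. *)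

theory Defs
  imports "HOL-Analysis.Analysis" "HOL-Probability.Essential_Supremum"
begin

text \<open>Lebesgue measure is the completed measure \<^const>\<open>lebesgue\<close>, so that Lebesgue measurable
  means measurable with respect to its sigma-algebra.\<close>

definition exponent_function :: "(real ^ 'n \<Rightarrow> ennreal) \<Rightarrow> bool" where
  "exponent_function p \<longleftrightarrow> p \<in> borel_measurable lebesgue \<and> (\<forall>x. 1 \<le> p x)"

definition exponent_upper :: "(real ^ 'n \<Rightarrow> ennreal) \<Rightarrow> ennreal" where
  "exponent_upper p = esssup lebesgue p"

text \<open>The power of a real \<open>s \<ge> 0\<close> with exponent in \<open>[1,\<infinity>]\<close>. For the infinite exponent
  the convention is that the power is \<open>0\<close> if \<open>s \<le> 1\<close> and \<open>\<infinity>\<close> if \<open>s > 1\<close>; for an essentially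
  bounded exponent function this case occurs only on a null set, so the choice is immaterial.\<close>

definition epow :: "real \<Rightarrow> ennreal \<Rightarrow> ennreal" where
  "epow s q = (if q = \<infinity> then (if s \<le> 1 then 0 else \<infinity>) else ennreal (s powr enn2real q))"

text \<open>Cubes are nondegenerate, closed, and have sides parallel to the coordinate axes.\<close>

definition cube :: "(real ^ 'n) set \<Rightarrow> bool" where
  "cube Q \<longleftrightarrow> (\<exists>a l. 0 < l \<and> Q = cbox a (\<chi> i. a $ i + l))"

text \<open>The value lies in \<^typ>\<open>ennreal\<close>, so that the infimum of the empty set is \<open>\<infinity>\<close>.\<close>

definition local_Lp_norm ::
    "(real ^ 'n \<Rightarrow> ennreal) \<Rightarrow> (real ^ 'n) set \<Rightarrow> (real ^ 'n \<Rightarrow> real) \<Rightarrow> ennreal" where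
  "local_Lp_norm p Q f =
     Inf {ennreal l | l. 0 < l \<and>
       (\<integral>\<^sup>+x\<in>Q. epow (\<bar>f x\<bar> / l) (p x) \<partial>lebesgue) / emeasure lebesgue Q \<le> 1}"

definition cube_avg :: "(real ^ 'n) set \<Rightarrow> (real ^ 'n \<Rightarrow> real) \<Rightarrow> real" where
  "cube_avg Q f = (LINT x:Q|lebesgue. f x) / measure lebesgue Q"

definition locally_integrable :: "(real ^ 'n \<Rightarrow> real) \<Rightarrow> bool" where
  "locally_integrable f \<longleftrightarrow> (\<forall>K. compact K \<longrightarrow> set_integrable lebesgue K f)"

definition bmo_norm :: "(real ^ 'n \<Rightarrow> real) \<Rightarrow> ennreal" where
  "bmo_norm f =
     (SUP Q\<in>{Q. cube Q}.
        (\<integral>\<^sup>+x\<in>Q. ennreal \<bar>f x - cube_avg Q f\<bar> \<partial>lebesgue) / emeasure lebesgue Q)"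

definition BMO :: "(real ^ 'n \<Rightarrow> real) set" where
  "BMO = {f. locally_integrable f \<and> bmo_norm f < \<infinity>}"

end

theory Submission
  imports Defs
begin

text \<open>The statement is the John--Nirenberg inequality in disguise. Let \<open>E\<close> be the set where
  \<open>\<bar>f - f\<^sub>Q\<bar> \<ge> t\<close>, put \<open>M = \<parallel>f\<parallel>\<close> (the BMO norm) and suppose
  \<open>\<bar>E\<bar> \<le> 2 exp (- c t / M) \<bar>Q\<bar>\<close>. Take \<open>\<lambda> = 2 exp (- c t / (P M))\<close> with \<open>P = max 1 p\<^sup>+\<close>. If
  \<open>\<lambda> \<ge> 1\<close>, the modular of \<open>\<chi>\<^sub>E / \<lambda>\<close> is at most \<open>1\<close> for trivial reasons; if \<open>\<lambda> < 1\<close>, it is at most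
  \<open>\<lambda> powr (- P) \<bar>E\<bar> / \<bar>Q\<bar> \<le> 2 powr (1 - P) \<le> 1\<close>. Hence the norm is at most \<open>\<lambda>\<close>, and \<open>C = c / P\<close>
  works. The case \<open>\<parallel>f\<parallel> = 0\<close> is the limit \<open>M \<rightarrow> 0\<close> of the same bound.

  The John--Nirenberg inequality \<open>John_Nirenberg\<close> is proved here by a bisection argument that avoids
  both the Calderon--Zygmund selection of maximal cubes and the Lebesgue differentiation theorem.
  A box whose side lengths differ at most by a factor \<open>2\<close> keeps this property when its longest side
  is halved, and it fills a fixed proportion of a cube, so the mean oscillation of \<open>f\<close> over such
  boxes is at most \<open>K = 2\<^sup>n\<^sup>+\<^sup>1 M\<close>. The boxes thus form binary trees in which every child has half the
  measure of its parent.

  On such a tree the stopping time argument becomes an induction on the depth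
  (\<open>superlevel_step\<close>): as long as the mean of \<open>\<bar>f - c\<bar>\<close> over a box is at most \<open>\<alpha>\<close>, descend to the two
  halves; at the first box \<open>R\<close> where it exceeds \<open>\<alpha>\<close> it is still at most \<open>2\<alpha>\<close>, so that \<open>c\<close> may be
  replaced by \<open>f\<^sub>R\<close> at the price of lowering the level by \<open>2\<alpha>\<close>, while the total measure of these boxes
  is at most \<open>\<alpha>\<^sup>-\<^sup>1\<close> times the integral of \<open>\<bar>f - c\<bar>\<close>. With \<open>\<alpha> = 2K\<close>, raising the level by \<open>4K\<close>
  halves the measure of the superlevel set.

  On the boxes of depth \<open>k\<close> that never stopped, the average of \<open>f\<close> is within \<open>\<alpha>\<close> of \<open>c\<close>, and \<open>f\<close>
  differs from its average by more than \<open>\<delta>\<close> only on a set of measure at most \<open>\<delta>\<^sup>-\<^sup>1\<close> times the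
  total oscillation over the boxes of depth \<open>k\<close>. That error, which is the same through the whole
  induction, tends to \<open>0\<close> as \<open>k\<close> grows because continuous functions are dense in \<open>L\<^sup>1\<close>
  (\<open>leaf_osc_small\<close>).\<close>

section \<open>Averages and superlevel sets over sets of finite measure\<close>

lemma set_integrable_const:
  "S \<in> fmeasurable M \<Longrightarrow> set_integrable M S (\<lambda>_. c::real)"
  unfolding set_integrable_def fmeasurable_def by simp

lemma set_integrable_abs_diff_const:
  fixes f :: "'a \<Rightarrow> real"
  assumes "S \<in> fmeasurable M" "set_integrable M S f"
  shows "set_integrable M S (\<lambda>x. \<bar>f x - c\<bar>)"
  using assms by (intro set_integrable_abs set_integral_diff set_integrable_const)

lemma set_lebesgue_integral_abs_nonneg: "0 \<le> (LINT x:S|M. \<bar>h x :: real\<bar>)"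
  unfolding set_lebesgue_integral_def by (intro Bochner_Integration.integral_nonneg) auto

lemma superlevel_in_fmeasurable:
  fixes f :: "'a \<Rightarrow> real"
  assumes S: "S \<in> fmeasurable M" and f: "set_integrable M S f"
  shows "{x \<in> S. s < \<bar>f x - c\<bar>} \<in> fmeasurable M" "{x \<in> S. s \<le> \<bar>f x - c\<bar>} \<in> fmeasurable M"
proof -
  have [measurable]: "(\<lambda>x. indicator S x *\<^sub>R f x) \<in> borel_measurable M"
    using f by (auto simp: set_integrable_def)
  have [measurable]: "S \<in> sets M" using S by auto
  have "{x \<in> space M. s < \<bar>indicator S x *\<^sub>R f x - c\<bar>} \<inter> S \<in> sets M"
    "{x \<in> space M. s \<le> \<bar>indicator S x *\<^sub>R f x - c\<bar>} \<inter> S \<in> sets M"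
    by measurable
  moreover have "{x \<in> space M. s < \<bar>indicator S x *\<^sub>R f x - c\<bar>} \<inter> S = {x \<in> S. s < \<bar>f x - c\<bar>}"
    "{x \<in> space M. s \<le> \<bar>indicator S x *\<^sub>R f x - c\<bar>} \<inter> S = {x \<in> S. s \<le> \<bar>f x - c\<bar>}"
    using sets.sets_into_space[OF \<open>S \<in> sets M\<close>] by auto
  ultimately show "{x \<in> S. s < \<bar>f x - c\<bar>} \<in> fmeasurable M" "{x \<in> S. s \<le> \<bar>f x - c\<bar>} \<in> fmeasurable M"
    by (auto intro!: fmeasurableI2[OF S])
qed

lemma set_Markov_inequality:
  fixes f :: "'a \<Rightarrow> real"
  assumes S: "S \<in> fmeasurable M" and f: "set_integrable M S f" and s: "0 < s"
  shows "measure M {x \<in> S. s < \<bar>f x - c\<bar>} \<le> (LINT x:S|M. \<bar>f x - c\<bar>) / s"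
proof -
  let ?E = "{x \<in> S. s < \<bar>f x - c\<bar>}"
  have E: "?E \<in> fmeasurable M" by (rule superlevel_in_fmeasurable(1)[OF S f])
  have i: "set_integrable M S (\<lambda>x. \<bar>f x - c\<bar>)" by (rule set_integrable_abs_diff_const[OF S f])
  have "s * measure M ?E = (LINT x:?E|M. s)"
    using fmeasurableD2[OF E] E by (subst set_integral_const) auto
  also have "\<dots> \<le> (LINT x:S|M. \<bar>f x - c\<bar>)"
    unfolding set_lebesgue_integral_def
    by (rule Bochner_Integration.integral_mono) (use i E set_integrable_const[OF E] in \<open>auto simp: set_integrable_def indicator_def\<close>)
  finally show ?thesis using s by (simp add: field_simps)
qed

lemma abs_avg_diff_le:
  fixes f g :: "real ^ 'n \<Rightarrow> real"
  assumes S: "S \<in> lmeasurable" and f: "set_integrable lebesgue S f"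
    and g: "set_integrable lebesgue S g"
  shows "measure lebesgue S * \<bar>cube_avg S f - cube_avg S g\<bar> \<le> (LINT x:S|lebesgue. \<bar>f x - g x\<bar>)"
proof (cases "measure lebesgue S = 0")
  case False
  then have "measure lebesgue S * \<bar>cube_avg S f - cube_avg S g\<bar>
      = \<bar>LINT x:S|lebesgue. f x - g x\<bar>"
    using f g by (simp add: cube_avg_def flip: diff_divide_distrib)
  also have "\<dots> \<le> (LINT x:S|lebesgue. \<bar>f x - g x\<bar>)"
    using integral_abs_bound[of lebesgue "\<lambda>x. indicator S x *\<^sub>R (f x - g x)"]
    by (simp add: set_lebesgue_integral_def abs_mult)
  finally show ?thesis .
qed (simp add: set_lebesgue_integral_abs_nonneg)

lemma cube_avg_const:
  "S \<in> lmeasurable \<Longrightarrow> 0 < measure lebesgue S \<Longrightarrow> cube_avg S (\<lambda>_. c) = c"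
  using fmeasurableD2[of S lebesgue] by (simp add: cube_avg_def set_integral_const fmeasurableD)

lemma abs_avg_minus_const_le:
  fixes f :: "real ^ 'n \<Rightarrow> real"
  assumes S: "S \<in> lmeasurable" and pos: "0 < measure lebesgue S" and f: "set_integrable lebesgue S f"
  shows "measure lebesgue S * \<bar>cube_avg S f - c\<bar> \<le> (LINT x:S|lebesgue. \<bar>f x - c\<bar>)"
  using abs_avg_diff_le[OF S f set_integrable_const[OF S, of c]] cube_avg_const[OF S pos]
  by simp

text \<open>The average is a best constant up to a factor \<open>2\<close>. This turns the oscillation over a set into one
  about the average over a larger set.\<close>

lemma mean_osc_le_twice:
  fixes f :: "real ^ 'n \<Rightarrow> real"
  assumes S: "S \<in> lmeasurable" and pos: "0 < measure lebesgue S" and f: "set_integrable lebesgue S f"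
  shows "(LINT x:S|lebesgue. \<bar>f x - cube_avg S f\<bar>) \<le> 2 * (LINT x:S|lebesgue. \<bar>f x - c\<bar>)"
proof -
  have "(LINT x:S|lebesgue. \<bar>f x - cube_avg S f\<bar>)
      \<le> (LINT x:S|lebesgue. \<bar>f x - c\<bar> + \<bar>cube_avg S f - c\<bar>)"
    using S f
    by (intro set_integral_mono set_integrable_abs_diff_const set_integral_add set_integrable_const) auto
  also have "\<dots> = (LINT x:S|lebesgue. \<bar>f x - c\<bar>) + \<bar>cube_avg S f - c\<bar> * measure lebesgue S"
    using S f fmeasurableD2[OF S]
    by (simp add: set_integrable_abs_diff_const set_integrable_const set_integral_const fmeasurableD)
  finally show ?thesis using abs_avg_minus_const_le[OF S pos f, of c] by (simp add: mult.commute)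
qed

text \<open>Cutting \<open>f\<close> off at a large height changes it little in \<open>L\<^sup>1\<close>. A measurable function is an
  a.e. limit of continuous functions, and cutting these off at the same height makes dominated
  convergence applicable on a set of finite measure.\<close>

lemma continuous_approx_L1:
  fixes f :: "'a::euclidean_space \<Rightarrow> real"
  assumes S: "S \<in> lmeasurable" and f: "set_integrable lebesgue S f" and e: "0 < e"
  obtains g where "continuous_on UNIV g" "set_integrable lebesgue S g"
    "(LINT x:S|lebesgue. \<bar>f x - g x\<bar>) < e"
proof -
  define u where "u x = indicator S x *\<^sub>R f x" for x
  define cl where "cl c r = max (-c) (min c r)" for c r :: real
  have u: "integrable lebesgue u" using f unfolding u_def[abs_def] set_integrable_def .
  then have um[measurable]: "u \<in> borel_measurable lebesgue" by auto
  have [measurable]: "S \<in> sets lebesgue" using S by auto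
  have clm[measurable]: "cl c \<in> borel_measurable borel" for c unfolding cl_def[abs_def] by measurable
  have cl_bound: "\<bar>cl c r\<bar> \<le> c" if "0 \<le> c" for c r using that unfolding cl_def by auto
  have cl_dom: "\<bar>r - cl c r\<bar> \<le> \<bar>r\<bar>" if "0 \<le> c" for c r using that unfolding cl_def by auto
  have cl_int: "set_integrable lebesgue S (\<lambda>x. cl c (h x))"
    if "0 \<le> c" and [measurable]: "h \<in> borel_measurable lebesgue" for c h
    by (rule set_integrable_bound[OF set_integrable_const[OF S, of c]])
      (use cl_bound[OF that(1)] in \<open>auto simp: set_borel_measurable_def that(1)\<close>)
  have "u measurable_on UNIV"
    by (rule lebesgue_measurable_imp_measurable_on_real) auto
  then obtain N h where N: "negligible N" and h: "\<And>n. continuous_on UNIV (h n)"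
    and lim: "\<And>x. x \<notin> N \<Longrightarrow> (\<lambda>n. h n x) \<longlonglongrightarrow> u x"
    unfolding measurable_on_def by auto
  have hm[measurable]: "h n \<in> borel_measurable lebesgue" for n
    using borel_measurable_continuous_onI[OF h] by (simp add: measurable_completion)
  have "AE x in lebesgue. x \<notin> N"
    using N by (simp add: AE_not_in negligible_iff_null_sets)
  then have lim_AE: "AE x in lebesgue. (\<lambda>n. h n x) \<longlonglongrightarrow> u x"
    by eventually_elim (rule lim)
  \<comment> \<open>The height of the cut-off is chosen first, dominated by \<open>\<bar>u\<bar>\<close>.\<close>
  have "(\<lambda>k. LINT x|lebesgue. \<bar>u x - cl (real k) (u x)\<bar>) \<longlonglongrightarrow> (LINT x|(lebesgue :: 'a measure). (0::real))"
  proof (rule integral_dominated_convergence[where w="\<lambda>x. \<bar>u x\<bar>"])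
    have "(\<lambda>k. \<bar>r - cl (real k) r\<bar>) \<longlonglongrightarrow> 0" for r :: real
    proof (rule tendsto_eventually)
      obtain n :: nat where "\<bar>r\<bar> \<le> n" using real_arch_simple by blast
      show "\<forall>\<^sub>F k in sequentially. \<bar>r - cl (real k) r\<bar> = 0"
        using eventually_ge_at_top[of n]
        by eventually_elim (use \<open>\<bar>r\<bar> \<le> n\<close> in \<open>auto simp: cl_def\<close>)
    qed
    then show "AE x in lebesgue. (\<lambda>k. \<bar>u x - cl (real k) (u x)\<bar>) \<longlonglongrightarrow> 0" by simp
  qed (use u cl_dom in auto)
  from eventually_happens'[OF sequentially_bot order_tendstoD(2)[OF this, of "e/2"]] e
  obtain k :: nat where k: "(LINT x|lebesgue. \<bar>u x - cl k (u x)\<bar>) < e/2"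
    by auto
  have i1: "set_integrable lebesgue S u"
    unfolding set_integrable_def using integrable_mult_indicator[OF \<open>S \<in> sets lebesgue\<close> u] .
  have ik: "set_integrable lebesgue S (\<lambda>x. cl k (u x))" by (rule cl_int) auto
  \<comment> \<open>At this fixed height the constant \<open>2k\<close> dominates on \<open>S\<close>.\<close>
  have "(\<lambda>n. LINT x:S|lebesgue. \<bar>cl k (u x) - cl k (h n x)\<bar>)
      \<longlonglongrightarrow> (LINT x|(lebesgue :: 'a measure). (0::real))"
    unfolding set_lebesgue_integral_def
  proof (rule integral_dominated_convergence[where w="\<lambda>x. indicator S x *\<^sub>R (2 * real k)"])
    show "AE x in lebesgue. (\<lambda>n. indicat_real S x *\<^sub>R \<bar>cl k (u x) - cl k (h n x)\<bar>) \<longlonglongrightarrow> 0"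
      using lim_AE
    proof eventually_elim
      case (elim x)
      have "(\<lambda>n. indicat_real S x *\<^sub>R \<bar>cl k (u x) - cl k (h n x)\<bar>)
          \<longlonglongrightarrow> indicat_real S x *\<^sub>R \<bar>cl k (u x) - cl k (u x)\<bar>"
        unfolding cl_def by (intro tendsto_intros elim)
      then show ?case by simp
    qed
    show "integrable lebesgue (\<lambda>x. indicat_real S x *\<^sub>R (2 * real k))"
      using set_integrable_const[OF S] unfolding set_integrable_def .
    show "AE x in lebesgue. norm (indicat_real S x *\<^sub>R \<bar>cl k (u x) - cl k (h n x)\<bar>)
            \<le> indicat_real S x *\<^sub>R (2 * real k)" for n
    proof (rule AE_I2)
      fix x
      show "norm (indicat_real S x *\<^sub>R \<bar>cl k (u x) - cl k (h n x)\<bar>)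
            \<le> indicat_real S x *\<^sub>R (2 * real k)"
        using cl_bound[of k "u x"] cl_bound[of k "h n x"] by (auto simp: indicator_def)
    qed
  qed auto
  from eventually_happens'[OF sequentially_bot order_tendstoD(2)[OF this, of "e/2"]] e
  obtain n where n: "(LINT x:S|lebesgue. \<bar>cl k (u x) - cl k (h n x)\<bar>) < e/2"
    by auto
  define g where "g x = cl k (h n x)" for x
  have g: "set_integrable lebesgue S g" unfolding g_def[abs_def] by (rule cl_int) auto
  have "(LINT x:S|lebesgue. \<bar>f x - g x\<bar>) = (LINT x:S|lebesgue. \<bar>u x - g x\<bar>)"
    by (rule set_lebesgue_integral_cong) (auto simp: u_def)
  also have "\<dots> \<le> (LINT x:S|lebesgue. \<bar>u x - cl k (u x)\<bar> + \<bar>cl k (u x) - g x\<bar>)"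
    using i1 ik g by (intro set_integral_mono set_integrable_abs set_integral_diff set_integral_add) auto
  also have "\<dots> = (LINT x:S|lebesgue. \<bar>u x - cl k (u x)\<bar>) + (LINT x:S|lebesgue. \<bar>cl k (u x) - g x\<bar>)"
    using i1 ik g by (intro set_integral_add set_integrable_abs set_integral_diff)
  also have "(LINT x:S|lebesgue. \<bar>u x - cl k (u x)\<bar>) = (LINT x|lebesgue. \<bar>u x - cl k (u x)\<bar>)"
    unfolding set_lebesgue_integral_def
    by (rule Bochner_Integration.integral_cong) (auto simp: u_def cl_def indicator_def)
  finally have "(LINT x:S|lebesgue. \<bar>f x - g x\<bar>) < e" using k n by (simp add: g_def)
  moreover have "continuous_on UNIV g"
    unfolding g_def[abs_def] cl_def by (intro continuous_intros h)
  ultimately show thesis using that g by blast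
qed

section \<open>Boxes of bounded eccentricity and their bisection\<close>

text \<open>All measures below are Lebesgue measures; the default rewriting of the measure of a box to its
  content would keep the lemmas on boxes from applying.\<close>

declare measure_completion [simp del]

text \<open>Ratio at most \<open>2\<close> between the sides is the bound that halving a longest side preserves:
  the old sides then lie between \<open>m\<close> and \<open>2m\<close>, where \<open>m\<close> is the length of the new one.\<close>

definition fat :: "real ^ 'n \<Rightarrow> real ^ 'n \<Rightarrow> bool" where
  "fat a b \<longleftrightarrow> (\<exists>l>0. \<forall>i. l \<le> b $ i - a $ i \<and> b $ i - a $ i \<le> 2 * l)"

definition long_side :: "real ^ 'n \<Rightarrow> real ^ 'n \<Rightarrow> 'n" where
  "long_side a b = (SOME i. \<forall>j. b $ j - a $ j \<le> b $ i - a $ i)"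

text \<open>Applied to the corners \<open>c = b\<close> and \<open>c = a\<close> of the box from \<open>a\<close> to \<open>b\<close>, this gives its two halves
  \<open>cbox a (midcut a b b)\<close> and \<open>cbox (midcut a b a) b\<close>.\<close>

definition midcut :: "real ^ 'n \<Rightarrow> real ^ 'n \<Rightarrow> real ^ 'n \<Rightarrow> real ^ 'n" where
  "midcut a b c = (\<chi> j. if j = long_side a b then (a $ j + b $ j) / 2 else c $ j)"

lemma long_side_max: "b $ j - a $ j \<le> b $ long_side a b - a $ long_side a b"
proof -
  have "\<exists>i. \<forall>j. b $ j - a $ j \<le> b $ i - a $ i"
    using ex_is_arg_min_if_finite[of UNIV "\<lambda>i. a $ i - b $ i"]
    by (simp add: is_arg_min_linorder) (smt (verit))
  then have "\<forall>j. b $ j - a $ j \<le> b $ long_side a b - a $ long_side a b"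
    unfolding long_side_def by (rule someI_ex)
  then show ?thesis ..
qed

lemma fat_less: "fat a b \<Longrightarrow> a $ i < b $ i"
  unfolding fat_def by (meson diff_gt_0_iff_gt less_le_trans)

lemma measure_fat_box: "fat a b \<Longrightarrow> measure lebesgue (cbox a b) = (\<Prod>i\<in>UNIV. b $ i - a $ i)"
  using fat_less[of a b] by (subst measure_completion) (auto simp: content_cbox_cart interval_ne_empty_cart less_imp_le)

lemma measure_fat_box_pos: "fat a b \<Longrightarrow> 0 < measure lebesgue (cbox a b)"
  using fat_less[of a b] by (auto simp: measure_fat_box intro!: prod_pos)

lemma fat_cut:
  assumes "fat a b"
  shows "fat a (midcut a b b)" and "fat (midcut a b a) b"
proof -
  let ?i = "long_side a b"
  define m where "m = (b $ ?i - a $ ?i) / 2"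
  obtain l where l: "0 < l" "\<And>i. l \<le> b $ i - a $ i" "\<And>i. b $ i - a $ i \<le> 2 * l"
    using assms unfolding fat_def by blast
  have "m \<le> b $ j - a $ j \<and> b $ j - a $ j \<le> 2 * m" for j
    using l(3)[of ?i] l(2)[of j] long_side_max[of b j a] by (simp add: m_def)
  moreover have "0 < m" using fat_less[OF assms, of ?i] by (simp add: m_def)
  ultimately show "fat a (midcut a b b)" "fat (midcut a b a) b"
    unfolding fat_def midcut_def by (auto intro!: exI[of _ m] simp: m_def field_simps)
qed

lemma measure_cut:
  assumes "fat a b"
  shows "measure lebesgue (cbox a (midcut a b b)) = measure lebesgue (cbox a b) / 2"
    and "measure lebesgue (cbox (midcut a b a) b) = measure lebesgue (cbox a b) / 2"
proof -
  let ?i = "long_side a b"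
  have "(\<Prod>j\<in>UNIV. midcut a b b $ j - a $ j) = (\<Prod>j\<in>UNIV. b $ j - a $ j) / 2"
       "(\<Prod>j\<in>UNIV. b $ j - midcut a b a $ j) = (\<Prod>j\<in>UNIV. b $ j - a $ j) / 2"
    by (simp_all add: prod.remove[of UNIV ?i] midcut_def field_simps)
  then show "measure lebesgue (cbox a (midcut a b b)) = measure lebesgue (cbox a b) / 2"
    "measure lebesgue (cbox (midcut a b a) b) = measure lebesgue (cbox a b) / 2"
    using assms by (simp_all add: measure_fat_box fat_cut)
qed

lemma cbox_cut:
  assumes "fat a b"
  shows "cbox a b = cbox a (midcut a b b) \<union> cbox (midcut a b a) b"
proof -
  let ?m = "(a $ long_side a b + b $ long_side a b) / 2"
  have le: "midcut a b b $ j \<le> b $ j" "a $ j \<le> midcut a b a $ j" for j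
    using fat_less[OF assms, of "long_side a b"] by (simp_all add: midcut_def)
  have "x \<in> cbox a (midcut a b b) \<or> x \<in> cbox (midcut a b a) b" if "x \<in> cbox a b" for x
    using that by (cases "x $ long_side a b \<le> ?m") (simp_all add: mem_box_cart midcut_def)
  moreover have "cbox a (midcut a b b) \<subseteq> cbox a b" "cbox (midcut a b a) b \<subseteq> cbox a b"
    unfolding subset_iff mem_box_cart by (meson le order_trans)+
  ultimately show ?thesis by blast
qed

lemma set_integrable_cut:
  fixes h :: "real ^ 'n \<Rightarrow> real"
  assumes fat: "fat a b" and h: "set_integrable lebesgue (cbox a b) h"
  shows "set_integrable lebesgue (cbox a (midcut a b b)) h" "set_integrable lebesgue (cbox (midcut a b a) b) h"
  using cbox_cut[OF fat] by (auto intro!: set_integrable_subset[OF h])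

text \<open>The two halves overlap, but only in a piece of a hyperplane.\<close>

lemma set_integral_cut:
  fixes h :: "real ^ 'n \<Rightarrow> real"
  assumes fat: "fat a b" and h: "set_integrable lebesgue (cbox a b) h"
  shows "(LINT x:cbox a b|lebesgue. h x)
    = (LINT x:cbox a (midcut a b b)|lebesgue. h x) + (LINT x:cbox (midcut a b a) b|lebesgue. h x)"
proof -
  let ?i = "long_side a b"
  have "cbox a (midcut a b b) \<inter> cbox (midcut a b a) b \<subseteq> {x. x $ ?i = (a $ ?i + b $ ?i) / 2}"
  proof
    fix x assume "x \<in> cbox a (midcut a b b) \<inter> cbox (midcut a b a) b"
    then have "x $ ?i \<le> midcut a b b $ ?i" "midcut a b a $ ?i \<le> x $ ?i"
      by (simp_all add: mem_box_cart)
    then show "x \<in> {x. x $ ?i = (a $ ?i + b $ ?i) / 2}" by (simp add: midcut_def)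
  qed
  moreover have "negligible {x. x \<bullet> axis ?i (1::real) = (a $ ?i + b $ ?i) / 2}"
    by (rule negligible_standard_hyperplane) simp
  then have "negligible {x. x $ ?i = (a $ ?i + b $ ?i) / 2}"
    by (simp add: inner_axis)
  ultimately have "negligible (cbox a (midcut a b b) \<inter> cbox (midcut a b a) b)"
    using negligible_subset by blast
  then have ae: "AE x in lebesgue. \<not> (x \<in> cbox a (midcut a b b) \<and> x \<in> cbox (midcut a b a) b)"
    by (simp add: negligible_iff_null_sets AE_iff_null_sets Int_def)
  show ?thesis
    unfolding cbox_cut[OF fat] 
    using set_integrable_cut[OF fat h] by (intro set_integral_Un_AE[OF ae]) auto
qed

section \<open>Total oscillation over the boxes of a given depth\<close>

text \<open>This is the \<open>L\<^sup>1\<close> distance on the box from \<open>a\<close> to \<open>b\<close> between \<open>f\<close> and its conditional expectation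
  on the partition into the \<open>2\<^sup>k\<close> boxes of depth \<open>k\<close>.\<close>

fun leaf_osc :: "(real ^ 'n \<Rightarrow> real) \<Rightarrow> nat \<Rightarrow> real ^ 'n \<Rightarrow> real ^ 'n \<Rightarrow> real" where
  "leaf_osc f 0 a b = (LINT x:cbox a b|lebesgue. \<bar>f x - cube_avg (cbox a b) f\<bar>)"
| "leaf_osc f (Suc k) a b = leaf_osc f k a (midcut a b b) + leaf_osc f k (midcut a b a) b"

lemma leaf_osc_nonneg: "0 \<le> leaf_osc f k a b"
  by (induction k arbitrary: a b) (auto simp: set_lebesgue_integral_abs_nonneg)

text \<open>Conditional expectation is a contraction of \<open>L\<^sup>1\<close>, so \<open>f\<close> may be exchanged for a nearby continuous
  function uniformly in the depth.\<close>

lemma leaf_osc_perturb: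
  assumes "fat a b" and "set_integrable lebesgue (cbox a b) f" and "set_integrable lebesgue (cbox a b) g"
  shows "leaf_osc f k a b \<le> leaf_osc g k a b + 2 * (LINT x:cbox a b|lebesgue. \<bar>f x - g x\<bar>)"
  using assms
proof (induction k arbitrary: a b)
  case 0
  let ?S = "cbox a b"
  let ?d = "\<bar>cube_avg ?S f - cube_avg ?S g\<bar>"
  note i = set_integrable_abs_diff_const[OF lmeasurable_cbox] set_integrable_const[OF lmeasurable_cbox]
  have fg: "set_integrable lebesgue ?S (\<lambda>x. \<bar>f x - g x\<bar>)"
    using 0 by (intro set_integrable_abs set_integral_diff)
  have "(LINT x:?S|lebesgue. \<bar>f x - cube_avg ?S f\<bar>)
      \<le> (LINT x:?S|lebesgue. \<bar>f x - g x\<bar> + (\<bar>g x - cube_avg ?S g\<bar> + ?d))"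
    using 0 fg by (intro set_integral_mono i set_integral_add) auto
  also have "\<dots> = (LINT x:?S|lebesgue. \<bar>f x - g x\<bar>) + (LINT x:?S|lebesgue. \<bar>g x - cube_avg ?S g\<bar>)
      + measure lebesgue ?S * ?d"
    using 0 fg by (simp add: i set_integral_const fmeasurableD fmeasurableD2)
  finally show ?case using abs_avg_diff_le[OF lmeasurable_cbox 0(2,3)] by simp
next
  case (Suc k)
  have "set_integrable lebesgue (cbox a b) (\<lambda>x. \<bar>f x - g x\<bar>)"
    using Suc.prems by (intro set_integrable_abs set_integral_diff)
  from set_integral_cut[OF Suc.prems(1) this]
    Suc.IH[of a "midcut a b b"] Suc.IH[of "midcut a b a" b] Suc.prems
  show ?case
    by (simp add: fat_cut set_integrable_cut)
qed

text \<open>For boxes of bounded eccentricity small measure forces small diameter. Since each bisection halves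
  the measure exactly, this is how the depth controls the size of the boxes.\<close>

lemma fat_box_diameter:
  fixes a b x y :: "real ^ 'n"
  assumes fat: "fat a b" and xy: "x \<in> cbox a b" "y \<in> cbox a b" and r: "0 < r"
    and small: "measure lebesgue (cbox a b) \<le> r ^ CARD('n)"
  shows "dist x y \<le> 2 * real CARD('n) * r"
proof -
  obtain l where l: "0 < l" "\<And>i. l \<le> b $ i - a $ i" "\<And>i. b $ i - a $ i \<le> 2 * l"
    using fat unfolding fat_def by blast
  have "l ^ CARD('n) = (\<Prod>i\<in>(UNIV::'n set). l)" by simp
  also have "\<dots> \<le> (\<Prod>i\<in>UNIV. b $ i - a $ i)" using l by (intro prod_mono) auto
  also have "\<dots> \<le> r ^ CARD('n)" using small measure_fat_box[OF fat] by simp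
  finally have "l \<le> r" using r l(1) by (simp add: power_mono_iff)
  have "\<bar>(x - y) $ i\<bar> \<le> 2 * r" for i
    using xy l(3)[of i] \<open>l \<le> r\<close> by (auto simp: mem_box_cart abs_le_iff) (smt (verit))+
  then have "norm (x - y) \<le> (\<Sum>i\<in>(UNIV::'n set). 2 * r)"
    by (intro order_trans[OF norm_le_l1_cart sum_mono]) auto
  then show ?thesis by (simp add: dist_norm)
qed

text \<open>The hypothesis on the measure says that the boxes of depth \<open>k\<close> have measure at most \<open>r\<^sup>n\<close>; it is in a
  form that passes to the two halves with \<open>k - 1\<close> in place of \<open>k\<close>.\<close>

lemma leaf_osc_le_of_small_variation:
  fixes a b :: "real ^ 'n"
  assumes "fat a b" and "set_integrable lebesgue (cbox a b) g" and r: "0 < r"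
    and "measure lebesgue (cbox a b) \<le> 2 ^ k * r ^ CARD('n)"
    and "\<And>x y. x \<in> cbox a b \<Longrightarrow> y \<in> cbox a b \<Longrightarrow> dist x y \<le> 2 * real CARD('n) * r \<Longrightarrow> \<bar>g x - g y\<bar> \<le> e"
  shows "leaf_osc g k a b \<le> 2 * e * measure lebesgue (cbox a b)"
  using assms(1,2,4,5)
proof (induction k arbitrary: a b)
  case 0
  let ?S = "cbox a b"
  have "a \<in> ?S" using fat_less[OF 0(1)] by (auto simp: mem_box_cart less_imp_le)
  have "leaf_osc g 0 a b \<le> 2 * (LINT x:?S|lebesgue. \<bar>g x - g a\<bar>)"
    using mean_osc_le_twice[OF lmeasurable_cbox measure_fat_box_pos 0(2)] 0(1) by simp
  also have "(LINT x:?S|lebesgue. \<bar>g x - g a\<bar>) \<le> (LINT x:?S|lebesgue. e)"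
    using 0 \<open>a \<in> ?S\<close> r fat_box_diameter[OF 0(1) _ _ r]
    by (intro set_integral_mono set_integrable_abs_diff_const set_integrable_const lmeasurable_cbox) auto
  also have "\<dots> = e * measure lebesgue ?S" by (simp add: set_integral_const fmeasurableD2)
  finally show ?case by simp
next
  case (Suc k)
  have sub: "cbox a (midcut a b b) \<subseteq> cbox a b" "cbox (midcut a b a) b \<subseteq> cbox a b"
    using cbox_cut[OF Suc.prems(1)] by auto
  have "leaf_osc g k a (midcut a b b) \<le> 2 * e * measure lebesgue (cbox a (midcut a b b))"
    using Suc.prems sub by (intro Suc.IH) (auto simp: fat_cut set_integrable_cut measure_cut)
  moreover have "leaf_osc g k (midcut a b a) b \<le> 2 * e * measure lebesgue (cbox (midcut a b a) b)"
    using Suc.prems sub by (intro Suc.IH) (auto simp: fat_cut set_integrable_cut measure_cut)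
  ultimately show ?case using Suc.prems by (simp add: measure_cut)
qed

lemma leaf_osc_small:
  fixes a b :: "real ^ 'n"
  assumes fat: "fat a b" and f: "set_integrable lebesgue (cbox a b) f" and e: "0 < e"
  obtains k where "leaf_osc f k a b < e"
proof -
  let ?V = "measure lebesgue (cbox a b)"
  have V: "0 < ?V" by (rule measure_fat_box_pos[OF fat])
  obtain g where g: "continuous_on UNIV g" "set_integrable lebesgue (cbox a b) g"
    "(LINT x:cbox a b|lebesgue. \<bar>f x - g x\<bar>) < e / 4"
    using continuous_approx_L1[OF lmeasurable_cbox f, of "e / 4"] e by auto
  define e' where "e' = e / (4 * ?V)"
  have e': "0 < e'" using e V by (simp add: e'_def)
  have "uniformly_continuous_on (cbox a b) g"
    by (intro compact_uniformly_continuous continuous_on_subset[OF g(1)] compact_cbox) auto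
  then obtain d where d: "0 < d"
    "\<And>x y. x \<in> cbox a b \<Longrightarrow> y \<in> cbox a b \<Longrightarrow> dist y x < d \<Longrightarrow> dist (g y) (g x) < e'"
    unfolding uniformly_continuous_on_def using e' by metis
  define r where "r = d / (4 * real CARD('n))"
  have r: "0 < r" "2 * real CARD('n) * r < d" using d(1) by (simp_all add: r_def)
  obtain k where k: "?V / r ^ CARD('n) < 2 ^ k"
    using real_arch_pow[of 2] by auto
  have "leaf_osc g k a b \<le> 2 * e' * ?V"
  proof (rule leaf_osc_le_of_small_variation[OF fat g(2) r(1)])
    show "?V \<le> 2 ^ k * r ^ CARD('n)" using k r(1) by (simp add: field_simps)
    show "\<bar>g x - g y\<bar> \<le> e'"
      if "x \<in> cbox a b" "y \<in> cbox a b" "dist x y \<le> 2 * real CARD('n) * r" for x y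
      using d(2)[of y x] that r(2) by (simp add: dist_real_def)
  qed
  also have "\<dots> = e / 2" using V by (simp add: e'_def)
  finally have "leaf_osc f k a b < e"
    using leaf_osc_perturb[OF fat f g(2), of k] g(3) by simp
  then show thesis by (rule that)
qed

section \<open>The John--Nirenberg inequality\<close>

text \<open>The stopping time argument. Here \<open>K\<close> is the stopping threshold for the mean of \<open>\<bar>f - c\<bar>\<close>, and \<open>hyp\<close>
  is the estimate already known at the lower level \<open>s\<close>, applied in each box at which the descent
  stops. The bound is additive over the two halves: this is why it carries the integral of
  \<open>\<bar>f - c\<bar>\<close> and not the measure of the box.\<close>

lemma superlevel_step:
  fixes f :: "real ^ 'n \<Rightarrow> real"
  assumes d: "0 < d" and K: "0 < K" and s: "0 \<le> s" and th: "0 \<le> \<theta>"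
    and hyp: "\<And>j a b. fat a b \<Longrightarrow> set_integrable lebesgue (cbox a b) f \<Longrightarrow>
      measure lebesgue {x \<in> cbox a b. s + d < \<bar>f x - cube_avg (cbox a b) f\<bar>}
        \<le> \<theta> * measure lebesgue (cbox a b) + leaf_osc f j a b / d"
  assumes "fat a b" and "set_integrable lebesgue (cbox a b) f"
    and "(LINT x:cbox a b|lebesgue. \<bar>f x - c\<bar>) \<le> K * measure lebesgue (cbox a b)"
  shows "measure lebesgue {x \<in> cbox a b. s + 2 * K + d < \<bar>f x - c\<bar>}
    \<le> \<theta> * (LINT x:cbox a b|lebesgue. \<bar>f x - c\<bar>) / K + leaf_osc f k a b / d"
  using assms(6-8)
proof (induction k arbitrary: a b)
  case 0
  let ?S = "cbox a b"
  have "measure lebesgue ?S * \<bar>cube_avg ?S f - c\<bar> \<le> measure lebesgue ?S * K"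
    using abs_avg_minus_const_le[OF lmeasurable_cbox measure_fat_box_pos[OF 0(1)] 0(2), of c] 0(3)
    by (simp add: mult.commute)
  then have "\<bar>cube_avg ?S f - c\<bar> \<le> K"
    using measure_fat_box_pos[OF 0(1)] by simp
  \<comment> \<open>The descent never stopped: \<open>f\<close> must be far from its average on this box.\<close>
  then have "{x \<in> ?S. s + 2 * K + d < \<bar>f x - c\<bar>} \<subseteq> {x \<in> ?S. d < \<bar>f x - cube_avg ?S f\<bar>}"
    using K s by auto
  then have "measure lebesgue {x \<in> ?S. s + 2 * K + d < \<bar>f x - c\<bar>}
      \<le> measure lebesgue {x \<in> ?S. d < \<bar>f x - cube_avg ?S f\<bar>}"
    using superlevel_in_fmeasurable[OF lmeasurable_cbox 0(2)]
    by (intro measure_mono_fmeasurable) (auto intro: fmeasurableD)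
  also have "\<dots> \<le> leaf_osc f 0 a b / d"
    using set_Markov_inequality[OF lmeasurable_cbox 0(2) d] by simp
  also have "\<dots> \<le> \<theta> * (LINT x:?S|lebesgue. \<bar>f x - c\<bar>) / K + leaf_osc f 0 a b / d"
    using th K by (simp add: set_lebesgue_integral_abs_nonneg)
  finally show ?case .
next
  case (Suc k)
  let ?S = "cbox a b" and ?S1 = "cbox a (midcut a b b)" and ?S2 = "cbox (midcut a b a) b"
  let ?I = "\<lambda>S. LINT x:S|lebesgue. \<bar>f x - c\<bar>"
  note fat = Suc.prems(1)
  have i: "set_integrable lebesgue ?S (\<lambda>x. \<bar>f x - c\<bar>)"
    by (rule set_integrable_abs_diff_const[OF lmeasurable_cbox Suc.prems(2)])
  have split: "?I ?S = ?I ?S1 + ?I ?S2" by (rule set_integral_cut[OF fat i])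
  have nonneg: "0 \<le> ?I S" for S by (rule set_lebesgue_integral_abs_nonneg)
  have half: "measure lebesgue {x \<in> cbox p q. s + 2 * K + d < \<bar>f x - c\<bar>}
      \<le> \<theta> * ?I (cbox p q) / K + leaf_osc f k p q / d"
    if pq: "fat p q" "set_integrable lebesgue (cbox p q) f"
      "measure lebesgue (cbox p q) = measure lebesgue ?S / 2" "?I (cbox p q) \<le> ?I ?S" for p q
  proof (cases "?I (cbox p q) \<le> K * measure lebesgue (cbox p q)")
    case True
    with pq show ?thesis by (intro Suc.IH)
  next
    case False
    \<comment> \<open>The descent stops at this half; as the parent did not stop and has only twice the measure,
      the mean of \<open>\<bar>f - c\<bar>\<close> here is at most \<open>2K\<close>.\<close>
    let ?P = "cbox p q"
    have pos: "0 < measure lebesgue ?P" by (rule measure_fat_box_pos[OF pq(1)])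
    have "measure lebesgue ?P * \<bar>cube_avg ?P f - c\<bar> \<le> ?I ?P"
      by (rule abs_avg_minus_const_le[OF lmeasurable_cbox pos pq(2)])
    also have "\<dots> \<le> measure lebesgue ?P * (2 * K)"
    proof -
      have "?I ?P \<le> K * measure lebesgue ?S" using pq(4) Suc.prems(3) by linarith
      also have "measure lebesgue ?S = 2 * measure lebesgue ?P" using pq(3) by simp
      finally show ?thesis by (simp add: mult_ac)
    qed
    finally have "\<bar>cube_avg ?P f - c\<bar> \<le> 2 * K" using pos by simp
    then have "{x \<in> ?P. s + 2 * K + d < \<bar>f x - c\<bar>} \<subseteq> {x \<in> ?P. s + d < \<bar>f x - cube_avg ?P f\<bar>}"
      by auto
    then have "measure lebesgue {x \<in> ?P. s + 2 * K + d < \<bar>f x - c\<bar>}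
        \<le> measure lebesgue {x \<in> ?P. s + d < \<bar>f x - cube_avg ?P f\<bar>}"
      using superlevel_in_fmeasurable[OF lmeasurable_cbox pq(2)]
      by (intro measure_mono_fmeasurable) (auto intro: fmeasurableD)
    also have "\<dots> \<le> \<theta> * measure lebesgue ?P + leaf_osc f k p q / d"
      by (rule hyp[OF pq(1,2)])
    also have "\<theta> * measure lebesgue ?P \<le> \<theta> * (?I ?P / K)"
    proof (rule mult_left_mono[OF _ th])
      show "measure lebesgue ?P \<le> ?I ?P / K"
        using False K by (simp add: le_divide_eq mult.commute)
    qed
    finally show ?thesis by simp
  qed
  have "{x \<in> ?S. s + 2 * K + d < \<bar>f x - c\<bar>} =
      {x \<in> ?S1. s + 2 * K + d < \<bar>f x - c\<bar>} \<union> {x \<in> ?S2. s + 2 * K + d < \<bar>f x - c\<bar>}"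
    using cbox_cut[OF fat] by auto
  then have "measure lebesgue {x \<in> ?S. s + 2 * K + d < \<bar>f x - c\<bar>} \<le>
      measure lebesgue {x \<in> ?S1. s + 2 * K + d < \<bar>f x - c\<bar>}
      + measure lebesgue {x \<in> ?S2. s + 2 * K + d < \<bar>f x - c\<bar>}"
    using superlevel_in_fmeasurable[OF lmeasurable_cbox set_integrable_cut(1)[OF fat Suc.prems(2)]]
      superlevel_in_fmeasurable[OF lmeasurable_cbox set_integrable_cut(2)[OF fat Suc.prems(2)]]
    by (simp only:) (intro measure_Un_le fmeasurableD)
  also have "\<dots> \<le> (\<theta> * ?I ?S1 / K + leaf_osc f k a (midcut a b b) / d)
      + (\<theta> * ?I ?S2 / K + leaf_osc f k (midcut a b a) b / d)"
    using fat Suc.prems(2) split nonneg[of ?S1] nonneg[of ?S2]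
    by (intro add_mono half) (auto simp: fat_cut set_integrable_cut measure_cut)
  also have "\<dots> = \<theta> * ?I ?S / K + leaf_osc f (Suc k) a b / d"
    unfolding split by (simp add: add_divide_distrib distrib_left)
  finally show ?case .
qed

text \<open>Each step uses the threshold \<open>2K\<close>, twice the mean oscillation: this gives the factor \<open>1/2\<close> and
  costs \<open>4K\<close> in the level. The slack \<open>d\<close> is the same at every
  step, so the error term does not accumulate.\<close>

lemma superlevel_geometric_up_to_leaf_osc:
  fixes f :: "real ^ 'n \<Rightarrow> real"
  assumes d: "0 < d" and K: "0 < K"
    and osc: "\<And>a b. fat a b \<Longrightarrow>
      (LINT x:cbox a b|lebesgue. \<bar>f x - cube_avg (cbox a b) f\<bar>) \<le> K * measure lebesgue (cbox a b)"
  assumes "fat a b" and "set_integrable lebesgue (cbox a b) f"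
  shows "measure lebesgue {x \<in> cbox a b. 4 * K * real m + d < \<bar>f x - cube_avg (cbox a b) f\<bar>}
    \<le> (1 / 2) ^ m * measure lebesgue (cbox a b) + leaf_osc f k a b / d"
  using assms(4,5)
proof (induction m arbitrary: a b k)
  case 0
  have "measure lebesgue {x \<in> cbox a b. d < \<bar>f x - cube_avg (cbox a b) f\<bar>} \<le> measure lebesgue (cbox a b)"
    using superlevel_in_fmeasurable[OF lmeasurable_cbox 0(2)]
    by (intro measure_mono_fmeasurable) (auto intro: fmeasurableD)
  moreover have "0 \<le> leaf_osc f k a b / d" using leaf_osc_nonneg[of f k a b] d by simp
  ultimately show ?case by simp
next
  case (Suc m)
  let ?S = "cbox a b" and ?A = "cube_avg (cbox a b) f"
  have V: "0 < measure lebesgue ?S" by (rule measure_fat_box_pos[OF Suc.prems(1)])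
  have "measure lebesgue {x \<in> ?S. 4 * K * real m + 2 * (2 * K) + d < \<bar>f x - ?A\<bar>}
      \<le> (1 / 2) ^ m * (LINT x:?S|lebesgue. \<bar>f x - ?A\<bar>) / (2 * K) + leaf_osc f k a b / d"
  proof (rule superlevel_step)
    have "K * measure lebesgue ?S \<le> 2 * K * measure lebesgue ?S" using K V by simp
    then show "(LINT x:?S|lebesgue. \<bar>f x - ?A\<bar>) \<le> 2 * K * measure lebesgue ?S"
      using osc[OF Suc.prems(1)] by linarith
  qed (use d K Suc in auto)
  also have "(1 / 2) ^ m * (LINT x:?S|lebesgue. \<bar>f x - ?A\<bar>) / (2 * K)
      \<le> (1 / 2) ^ m * (K * measure lebesgue ?S) / (2 * K)"
    using osc[OF Suc.prems(1)] K by (intro divide_right_mono mult_left_mono) auto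
  also have "\<dots> = (1 / 2) ^ Suc m * measure lebesgue ?S" using K by simp
  finally show ?case by (simp add: algebra_simps)
qed

lemma superlevel_geometric:
  fixes f :: "real ^ 'n \<Rightarrow> real"
  assumes d: "0 < d" and K: "0 < K"
    and osc: "\<And>a b. fat a b \<Longrightarrow>
      (LINT x:cbox a b|lebesgue. \<bar>f x - cube_avg (cbox a b) f\<bar>) \<le> K * measure lebesgue (cbox a b)"
    and fat: "fat a b" and f: "set_integrable lebesgue (cbox a b) f"
  shows "measure lebesgue {x \<in> cbox a b. 4 * K * real m + d < \<bar>f x - cube_avg (cbox a b) f\<bar>}
    \<le> (1 / 2) ^ m * measure lebesgue (cbox a b)"
proof (rule field_le_epsilon)
  fix e :: real assume e: "0 < e"
  obtain k where k: "leaf_osc f k a b < e * d"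
    using leaf_osc_small[OF fat f, of "e * d"] e d by auto
  then have "leaf_osc f k a b / d \<le> e" using d by (simp add: field_simps)
  with superlevel_geometric_up_to_leaf_osc[OF d K osc fat f, of m k]
  show "measure lebesgue {x \<in> cbox a b. 4 * K * real m + d < \<bar>f x - cube_avg (cbox a b) f\<bar>}
    \<le> (1 / 2) ^ m * measure lebesgue (cbox a b) + e" by linarith
qed

lemma cubeE_fat:
  assumes "cube Q"
  obtains a b where "Q = cbox a b" "fat a b"
proof -
  obtain a l where al: "0 < l" "Q = cbox a (\<chi> i. a $ i + l)"
    using assms unfolding cube_def by blast
  have "fat a (\<chi> i. a $ i + l)" unfolding fat_def using al(1) by (auto intro!: exI[of _ l])
  with al(2) show thesis by (rule that)
qed

text \<open>The box lies in a cube whose side \<open>2l\<close> is at most twice the shortest side of the box, hence of at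
  most \<open>2\<^sup>n\<close> times its measure.\<close>

lemma fat_box_osc_le:
  fixes f :: "real ^ 'n \<Rightarrow> real"
  assumes M: "0 \<le> M" and loc: "locally_integrable f"
    and osc: "\<And>Q. cube Q \<Longrightarrow> (LINT x:Q|lebesgue. \<bar>f x - cube_avg Q f\<bar>) \<le> M * measure lebesgue Q"
    and fat: "fat a b"
  shows "(LINT x:cbox a b|lebesgue. \<bar>f x - cube_avg (cbox a b) f\<bar>)
    \<le> 2 ^ (CARD('n) + 1) * M * measure lebesgue (cbox a b)"
proof -
  obtain l where l: "0 < l" "\<And>i. l \<le> b $ i - a $ i" "\<And>i. b $ i - a $ i \<le> 2 * l"
    using fat unfolding fat_def by blast
  define c where "c = (\<chi> i. a $ i + 2 * l)"
  let ?S = "cbox a b" and ?Q = "cbox a c"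
  have Q: "cube ?Q" unfolding cube_def c_def using l(1) by (auto intro!: exI[of _ a] exI[of _ "2 * l"])
  have fat': "fat a c" unfolding fat_def c_def using l(1) by (auto intro!: exI[of _ "2 * l"])
  have sub: "?S \<subseteq> ?Q" 
  proof
    fix x assume "x \<in> ?S"
    then have "a $ i \<le> x $ i \<and> x $ i \<le> b $ i" for i by (simp add: mem_box_cart)
    then have "a $ i \<le> x $ i \<and> x $ i \<le> a $ i + 2 * l" for i using l(3)[of i] by (smt (verit))
    then show "x \<in> ?Q" by (simp add: mem_box_cart c_def)
  qed
  have f: "set_integrable lebesgue S f" if "compact S" for S
    using loc that unfolding locally_integrable_def by blast
  have "measure lebesgue ?Q = 2 ^ CARD('n) * (\<Prod>i\<in>(UNIV::'n set). l)"
    unfolding measure_fat_box[OF fat'] by (simp add: c_def power_mult_distrib)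
  also have "(\<Prod>i\<in>(UNIV::'n set). l) \<le> measure lebesgue ?S"
    unfolding measure_fat_box[OF fat] using l by (intro prod_mono) auto
  finally have vol: "measure lebesgue ?Q \<le> 2 ^ CARD('n) * measure lebesgue ?S" by simp
  have "(LINT x:?S|lebesgue. \<bar>f x - cube_avg ?S f\<bar>) \<le> 2 * (LINT x:?S|lebesgue. \<bar>f x - cube_avg ?Q f\<bar>)"
    by (rule mean_osc_le_twice[OF lmeasurable_cbox measure_fat_box_pos[OF fat] f]) simp
  also have "(LINT x:?S|lebesgue. \<bar>f x - cube_avg ?Q f\<bar>) \<le> (LINT x:?Q|lebesgue. \<bar>f x - cube_avg ?Q f\<bar>)"
    unfolding set_lebesgue_integral_def
    by (rule Bochner_Integration.integral_mono)
      (use sub set_integrable_abs_diff_const[OF lmeasurable_cbox f[OF compact_cbox]] in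
        \<open>auto simp: set_integrable_def indicator_def\<close>)
  also have "\<dots> \<le> M * measure lebesgue ?Q" by (rule osc[OF Q])
  also have "\<dots> \<le> M * (2 ^ CARD('n) * measure lebesgue ?S)" using vol M by (rule mult_left_mono)
  finally show ?thesis by (simp add: mult_ac)
qed

text \<open>Any upper bound \<open>M\<close> of the norm is allowed, so that functions of norm \<open>0\<close> need no separate
  treatment before the very end.\<close>

lemma bmo_norm_bound:
  fixes f :: "real ^ 'n \<Rightarrow> real"
  assumes loc: "locally_integrable f" and M: "0 \<le> M" "bmo_norm f \<le> ennreal M" and Q: "cube Q"
  shows "(LINT x:Q|lebesgue. \<bar>f x - cube_avg Q f\<bar>) \<le> M * measure lebesgue Q"
proof -
  obtain a b where ab: "Q = cbox a b" "fat a b" using cubeE_fat[OF Q] .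
  have pos: "0 < measure lebesgue Q" using measure_fat_box_pos[OF ab(2)] ab(1) by simp
  have Qm: "Q \<in> lmeasurable" using ab by simp
  have f: "set_integrable lebesgue Q f" using loc ab(1) unfolding locally_integrable_def by simp
  have i: "set_integrable lebesgue Q (\<lambda>x. \<bar>f x - cube_avg Q f\<bar>)"
    by (rule set_integrable_abs_diff_const[OF Qm f])
  have "(\<integral>\<^sup>+x\<in>Q. ennreal \<bar>f x - cube_avg Q f\<bar> \<partial>lebesgue) / emeasure lebesgue Q \<le> ennreal M"
    using M(2) Q unfolding bmo_norm_def by (auto simp: SUP_le_iff)
  moreover have "(\<integral>\<^sup>+x\<in>Q. ennreal \<bar>f x - cube_avg Q f\<bar> \<partial>lebesgue)
      = ennreal (LINT x:Q|lebesgue. \<bar>f x - cube_avg Q f\<bar>)"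
    using i unfolding set_integrable_def set_lebesgue_integral_def
    by (subst nn_integral_eq_integral[symmetric])
      (auto intro!: nn_integral_cong simp: indicator_def)
  ultimately show ?thesis
    using pos M(1) Qm
    by (simp add: emeasure_eq_measure2 divide_ennreal set_lebesgue_integral_abs_nonneg field_simps)
qed

theorem John_Nirenberg:
  fixes f :: "real ^ 'n \<Rightarrow> real"
  assumes loc: "locally_integrable f" and M: "0 < M" "bmo_norm f \<le> ennreal M"
    and Q: "cube Q" and t: "0 < t"
  shows "measure lebesgue {x \<in> Q. t \<le> \<bar>f x - cube_avg Q f\<bar>}
    \<le> 2 * exp (- (ln 2 / 2 ^ (CARD('n) + 3) * t / M)) * measure lebesgue Q"
proof -
  obtain a b where ab: "Q = cbox a b" "fat a b" using cubeE_fat[OF Q] .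
  have f: "set_integrable lebesgue Q f" using loc ab(1) unfolding locally_integrable_def by simp
  define K where "K = 2 ^ (CARD('n) + 1) * M"
  have K: "0 < K" using M by (simp add: K_def)
  define r where "r = t / (4 * K)"
  have r: "0 < r" using t K by (simp add: r_def)
  \<comment> \<open>The largest \<open>m\<close> with \<open>4Km < t\<close>; the strict inequality leaves room for \<open>d > 0\<close>, and \<open>r \<le> m + 1\<close>
    is the source of the factor \<open>2\<close>.\<close>
  define m where "m = nat (\<lceil>r\<rceil> - 1)"
  have m: "real m < r" "r \<le> real m + 1" using r unfolding m_def by linarith+
  define d where "d = (t - 4 * K * real m) / 2"
  have "4 * K * real m < t" using m(1) K by (simp add: r_def field_simps)
  then have d: "0 < d" "4 * K * real m + d < t" by (simp_all add: d_def field_simps)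
  have sub: "{x \<in> Q. t \<le> \<bar>f x - cube_avg Q f\<bar>} \<subseteq> {x \<in> Q. 4 * K * real m + d < \<bar>f x - cube_avg Q f\<bar>}"
    using d(2) by auto
  have "measure lebesgue {x \<in> Q. t \<le> \<bar>f x - cube_avg Q f\<bar>}
      \<le> measure lebesgue {x \<in> Q. 4 * K * real m + d < \<bar>f x - cube_avg Q f\<bar>}"
    using superlevel_in_fmeasurable[OF _ f] ab(1) sub
    by (intro measure_mono_fmeasurable) (auto intro: fmeasurableD)
  also have "\<dots> \<le> (1 / 2) ^ m * measure lebesgue Q"
    unfolding ab(1)
  proof (rule superlevel_geometric[OF d(1) K _ ab(2)])
    show "(LINT x:cbox a b|lebesgue. \<bar>f x - cube_avg (cbox a b) f\<bar>) \<le> K * measure lebesgue (cbox a b)"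
      if "fat a b" for a b :: "real ^ 'n"
      unfolding K_def using M bmo_norm_bound[OF loc] by (intro fat_box_osc_le[OF _ loc _ that]) auto
  qed (use f ab in auto)
  also have "(1 / 2) ^ m \<le> 2 * exp (- (ln 2 / 2 ^ (CARD('n) + 3) * t / M))"
  proof -
    have "(1 / 2) ^ m = 2 * (exp (- (real m * ln 2)) * exp (- ln 2 :: real))"
      using exp_of_nat_mult[of m "ln 2 :: real"]
      by (simp add: exp_minus power_one_over inverse_eq_divide)
    also have "\<dots> = 2 * exp (- (ln 2 * (real m + 1)))"
      by (simp add: algebra_simps flip: exp_add)
    also have "\<dots> \<le> 2 * exp (- (ln 2 * r))" using m(2) by simp
    also have "ln 2 * r = ln 2 / 2 ^ (CARD('n) + 3) * t / M"
      by (simp add: r_def K_def power_add)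
    finally show ?thesis .
  qed
  finally show ?thesis by (simp add: mult_right_mono)
qed

section \<open>Variable exponent norms of indicator functions\<close>

text \<open>For \<open>l \<le> 1\<close> the power \<open>(1/l)\<^sup>p\<close> increases with \<open>p\<close>, and \<open>p \<le> p\<^sup>+ < \<infinity>\<close> holds almost everywhere.\<close>

lemma set_nn_integral_epow_indicator_le:
  fixes p :: "real ^ 'n \<Rightarrow> ennreal"
  assumes p: "exponent_upper p < \<infinity>" and l: "0 < l" "l \<le> 1"
    and E: "E \<in> sets lebesgue" "E \<subseteq> Q"
  shows "(\<integral>\<^sup>+x\<in>Q. epow (\<bar>indicat_real E x\<bar> / l) (p x) \<partial>lebesgue)
    \<le> ennreal ((1 / l) powr enn2real (exponent_upper p)) * emeasure lebesgue E"
proof -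
  let ?c = "(1 / l) powr enn2real (exponent_upper p)"
  have "AE x in lebesgue. p x \<le> exponent_upper p"
    unfolding exponent_upper_def by (rule esssup_AE)
  then have "AE x in lebesgue.
      epow (\<bar>indicat_real E x\<bar> / l) (p x) * indicator Q x \<le> ennreal ?c * indicator E x"
  proof eventually_elim
    case (elim x)
    then have fin: "p x \<noteq> \<infinity>" using p by auto
    have "enn2real (p x) \<le> enn2real (exponent_upper p)"
      using elim p by (intro enn2real_mono) (auto simp: less_top)
    then have "(1 / l) powr enn2real (p x) \<le> ?c"
      using l by (intro powr_mono) auto
    then show ?case
      using E(2) fin by (auto simp: epow_def indicator_def intro: ennreal_leI)
  qed
  then have "(\<integral>\<^sup>+x\<in>Q. epow (\<bar>indicat_real E x\<bar> / l) (p x) \<partial>lebesgue)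
      \<le> (\<integral>\<^sup>+x. ennreal ?c * indicator E x \<partial>lebesgue)"
    by (rule nn_integral_mono_AE)
  then show ?thesis using E(1) by (simp add: nn_integral_cmult_indicator)
qed

lemma local_Lp_norm_indicator_le:
  fixes p :: "real ^ 'n \<Rightarrow> ennreal"
  assumes p: "exponent_upper p < \<infinity>" and l: "0 < l"
    and Q: "Q \<in> lmeasurable" "0 < measure lebesgue Q"
    and E: "E \<in> sets lebesgue" "E \<subseteq> Q"
    and small: "l < 1 \<Longrightarrow>
      (1 / l) powr enn2real (exponent_upper p) * measure lebesgue E \<le> measure lebesgue Q"
  shows "local_Lp_norm p Q (indicat_real E) \<le> ennreal l"
proof -
  have Em: "E \<in> lmeasurable" using E Q by (auto intro: fmeasurableI2)
  have eE: "emeasure lebesgue E = ennreal (measure lebesgue E)"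
    and eQ: "emeasure lebesgue Q = ennreal (measure lebesgue Q)"
    using Em Q by (auto simp: emeasure_eq_measure2)
  have "(\<integral>\<^sup>+x\<in>Q. epow (\<bar>indicat_real E x\<bar> / l) (p x) \<partial>lebesgue) \<le> emeasure lebesgue Q"
  proof (cases "l < 1")
    case True
    have "(\<integral>\<^sup>+x\<in>Q. epow (\<bar>indicat_real E x\<bar> / l) (p x) \<partial>lebesgue)
        \<le> ennreal ((1 / l) powr enn2real (exponent_upper p)) * emeasure lebesgue E"
      using True by (intro set_nn_integral_epow_indicator_le p l E) auto
    also have "\<dots> \<le> emeasure lebesgue Q"
      unfolding eE eQ using small[OF True] by (simp flip: ennreal_mult' add: ennreal_leI)
    finally show ?thesis .
  next
    case False
    have le1: "epow s q \<le> 1" if "0 \<le> s" "s \<le> 1" for s q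
      using that by (auto simp: epow_def powr_le1 ennreal_le_1)
    have "(\<integral>\<^sup>+x\<in>Q. epow (\<bar>indicat_real E x\<bar> / l) (p x) \<partial>lebesgue)
        \<le> (\<integral>\<^sup>+x. indicator Q x \<partial>lebesgue)"
      using False by (intro nn_integral_mono) (auto simp: indicator_def intro!: le1)
    then show ?thesis using Q(1) by (simp add: fmeasurableD)
  qed
  then have "(\<integral>\<^sup>+x\<in>Q. epow (\<bar>indicat_real E x\<bar> / l) (p x) \<partial>lebesgue) / emeasure lebesgue Q
      \<le> emeasure lebesgue Q / emeasure lebesgue Q"
    by (rule divide_right_mono_ennreal)
  also have "\<dots> = 1" using Q(2) unfolding eQ by (simp add: divide_ennreal)
  finally show ?thesis
    unfolding local_Lp_norm_def using l by (intro Inf_lower) auto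
qed

text \<open>Dividing the exponential rate by \<open>P \<ge> p\<^sup>+\<close> compensates for the power \<open>P\<close> in the modular. The
  factor \<open>2\<close> survives because \<open>2 powr P \<ge> 2\<close> absorbs the one from \<open>John_Nirenberg\<close>.\<close>

lemma local_Lp_norm_superlevel_le:
  fixes p :: "real ^ 'n \<Rightarrow> ennreal" and f :: "real ^ 'n \<Rightarrow> real"
  assumes p: "exponent_upper p < \<infinity>"
    and loc: "locally_integrable f" and M: "0 < M" "bmo_norm f \<le> ennreal M"
    and Q: "cube Q" and t: "0 < t"
  defines "P \<equiv> max 1 (enn2real (exponent_upper p))"
  shows "local_Lp_norm p Q (indicat_real {x \<in> Q. \<bar>f x - cube_avg Q f\<bar> \<ge> t})
    \<le> ennreal (2 * exp (- (ln 2 / 2 ^ (CARD('n) + 3) / P * t / M)))"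
proof -
  obtain a b where ab: "Q = cbox a b" "fat a b" using cubeE_fat[OF Q] .
  have f: "set_integrable lebesgue Q f" using loc ab(1) unfolding locally_integrable_def by simp
  have Qm: "Q \<in> lmeasurable" "0 < measure lebesgue Q"
    using measure_fat_box_pos[OF ab(2)] ab(1) by auto
  let ?E = "{x \<in> Q. \<bar>f x - cube_avg Q f\<bar> \<ge> t}"
  define w where "w = ln 2 / 2 ^ (CARD('n) + 3) * t / M"
  have P: "1 \<le> P" "enn2real (exponent_upper p) \<le> P" by (simp_all add: P_def)
  have E: "measure lebesgue ?E \<le> 2 * exp (- w) * measure lebesgue Q"
    unfolding w_def by (rule John_Nirenberg[OF loc M Q t])
  define l where "l = 2 * exp (- (w / P))"
  have "local_Lp_norm p Q (indicat_real ?E) \<le> ennreal (2 * exp (- (w / P)))"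
    unfolding l_def[symmetric]
  proof (rule local_Lp_norm_indicator_le[OF p])
    show "?E \<in> sets lebesgue" using superlevel_in_fmeasurable[OF Qm(1) f] by (auto intro: fmeasurableD)
    show "(1 / l) powr enn2real (exponent_upper p) * measure lebesgue ?E \<le> measure lebesgue Q"
      if "l < 1"
    proof -
      have "(1 / l) powr enn2real (exponent_upper p) \<le> (1 / l) powr P"
        using that P by (intro powr_mono) (auto simp: l_def)
      also have "(1 / l) powr P = exp w / 2 powr P"
      proof -
        have "1 / l = exp (w / P) / 2" by (simp add: l_def exp_minus field_simps)
        then have "(1 / l) powr P = (exp (w / P) / 2) powr P" by (simp only:)
        then show ?thesis using P(1) by (simp add: powr_divide exp_powr_real)
      qed
      also have "\<dots> \<le> exp w / 2"
        using P(1) powr_mono[of 1 P 2] by (intro divide_left_mono) auto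
      finally have "(1 / l) powr enn2real (exponent_upper p) * measure lebesgue ?E
          \<le> exp w / 2 * (2 * exp (- w) * measure lebesgue Q)"
        using E by (rule mult_mono) auto
      also have "\<dots> = (exp w * exp (- w)) * measure lebesgue Q" by simp
      also have "exp w * exp (- w) = 1" by (simp add: exp_minus)
      finally show ?thesis by simp
    qed
  qed (use Qm in \<open>auto simp: l_def\<close>)
  also have "w / P = ln 2 / 2 ^ (CARD('n) + 3) / P * t / M"
    by (simp add: w_def)
  finally show ?thesis .
qed

theorem corollary1p3:
  shows "\<exists>C :: ennreal \<Rightarrow> real.
    \<forall>p :: real ^ 'n \<Rightarrow> ennreal. exponent_function p \<and> exponent_upper p < \<infinity> \<longrightarrow>
      0 < C (exponent_upper p) \<and>
      (\<forall>t Q f. 0 < t \<and> cube Q \<and> f \<in> BMO \<longrightarrow>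
        local_Lp_norm p Q (indicat_real {x \<in> Q. \<bar>f x - cube_avg Q f\<bar> \<ge> t})
          \<le> (if bmo_norm f = 0 then 0
             else ennreal (2 * exp (- (C (exponent_upper p) * t / enn2real (bmo_norm f))))))"
proof (intro exI allI impI conjI)
  let ?C = "\<lambda>P. ln 2 / 2 ^ (CARD('n) + 3) / max 1 (enn2real P)"
  fix p :: "real ^ 'n \<Rightarrow> ennreal"
  assume "exponent_function p \<and> exponent_upper p < \<infinity>"
  then have p: "exponent_upper p < \<infinity>" ..
  show pos: "0 < ?C (exponent_upper p)" by simp
  fix t :: real and Q :: "(real ^ 'n) set" and f :: "real ^ 'n \<Rightarrow> real"
  assume *: "0 < t \<and> cube Q \<and> f \<in> BMO"
  then have loc: "locally_integrable f" and fin: "bmo_norm f < \<infinity>" by (auto simp: BMO_def)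
  let ?N = "local_Lp_norm p Q (indicat_real {x \<in> Q. \<bar>f x - cube_avg Q f\<bar> \<ge> t})"
  have bound: "?N \<le> ennreal (2 * exp (- (?C (exponent_upper p) * t / M)))"
    if "0 < M" "bmo_norm f \<le> ennreal M" for M
    using local_Lp_norm_superlevel_le[OF p loc that] * by auto
  show "?N \<le> (if bmo_norm f = 0 then 0
      else ennreal (2 * exp (- (?C (exponent_upper p) * t / enn2real (bmo_norm f)))))"
  proof (cases "bmo_norm f = 0")
    case False
    then show ?thesis
      using bound[of "enn2real (bmo_norm f)"] fin by (simp add: enn2real_positive_iff less_top zero_less_iff_neq_zero)
  next
    case True
    have "?N \<le> 0"
    proof (rule ennreal_le_epsilon)
      fix e :: real assume e: "0 < e"
      \<comment> \<open>The bound \<open>M = c/r\<close> on the norm is chosen so that the estimate reads \<open>2 exp (- r) \<le> e\<close>.\<close>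
      define r where "r = max 1 (ln (2 / e))"
      define c where "c = ?C (exponent_upper p) * t"
      have c: "0 < c" using pos * unfolding c_def by (simp only: mult_pos_pos)
      have r: "0 < r" "ln (2 / e) \<le> r" by (auto simp: r_def)
      have "2 * exp (- (c / (c / r))) = 2 * exp (- r)" using c by simp
      also have "\<dots> \<le> 2 * exp (- ln (2 / e))" using r(2) by simp
      also have "\<dots> = e" using e by (simp add: exp_minus)
      finally have small: "2 * exp (- (c / (c / r))) \<le> e" .
      have "?N \<le> ennreal (2 * exp (- (c / (c / r))))"
        using bound[of "c / r", folded c_def] c r(1) True by simp
      also have "\<dots> \<le> ennreal e" using small by (rule ennreal_leI)
      finally show "?N \<le> 0 + ennreal e" by simp
    qed
    with True show ?thesis by simp
  qed
qed

end
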